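(* Let $D$ be a function on $[0,\infty)$ of the form $$D(r)=\int_{(0,\infty)}(1-e^{-rt})\,\nu(dt)+Ar,$$ with $A\ge0$ a constant and $\nu$ a $\sigma$-finite measure on $(0,\infty)$ satisfying $\int_{(0,\infty)}\frac{t}{1+t}\nu(dt)<\infty$, and assume the Smoothness and Pinning assumptions stated in the context. Then for all $r>0$, $$-2D''(0)>(\alpha r+\beta)\beta,$$ where $$\alpha=\alpha(r)=\frac{2D''(r)}{\sqrt{D(r)-\frac{D'(r)^2r}{D'(0)}}},\qquad \beta=\beta(r)=\frac{D'(r)-D'(0)}{\sqrt{D(r)-\frac{D'(r)^2r}{D'(0)}}}.$$
   Context: Functions $D$ of the displayed form (Bernstein functions with $D(0)=0$) are the structure functions of non-isotropic Gaussian fields with isotropic increments that can be defined on $\mathbb{R}^N$ for every $N\in\mathbb{N}$: centered Gaussian processes $H_N=\{H_N(x):x\in\mathbb{R}^N\}$ with $\mathbb{E}[(H_N(x)-H_N(y))^2]=D(\|x-y\|^2)$. **Smoothness assumption.** $D$ is four times differentiable at $0$ (one-sided) and $0<|D^{(4)}(0)|<\infty$. **Pinning assumption.** The associated field satisfies $H_N(0)=0$. *)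

theory Defs
  imports "HOL-Probability.Probability"
begin

text \<open>Differentiation of functions on \<open>[0, \<infinity>)\<close>: one-sided at \<open>0\<close>, two-sided at \<open>x > 0\<close>;
  values of the function at negative arguments are irrelevant.\<close>

definition deriv_halfline :: "(real \<Rightarrow> real) \<Rightarrow> real \<Rightarrow> real" where
  "deriv_halfline f x = vector_derivative f (at x within {0..})"

abbreviation nth_deriv_halfline :: "nat \<Rightarrow> (real \<Rightarrow> real) \<Rightarrow> real \<Rightarrow> real" where
  "nth_deriv_halfline k f \<equiv> (deriv_halfline ^^ k) f"

lemma deriv_halfline_eqI:
  assumes "(f has_real_derivative d) (at x within {0..})" "x \<ge> 0"
  shows "deriv_halfline f x = d"
proof -
  have "at x within {0..} \<noteq> bot"
  proof -
    have "{x..x+1} \<subseteq> {0..}" using assms(2) by auto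
    moreover have "at x within {x..x+1} \<noteq> bot" by (simp add: at_within_Icc_at_right)
    ultimately show ?thesis by (metis at_le bot.extremum_uniqueI)
  qed
  then show ?thesis
    unfolding deriv_halfline_def
    using assms(1) vector_derivative_within has_real_derivative_iff_has_vector_derivative by blast
qed

lemma deriv_halfline_eq_deriv:
  assumes "f field_differentiable at x" "x > 0"
  shows "deriv_halfline f x = deriv f x"
  using assms deriv_halfline_eqI DERIV_deriv_iff_field_differentiable
    has_field_derivative_at_within less_imp_le by metis

text \<open>\<open>f\<close> is \<open>n\<close> times differentiable at \<open>0\<close> from the right: the derivatives of order \<open>< n\<close>
  exist on some \<open>[0, \<epsilon>)\<close>, and the one of order \<open>n - 1\<close> is differentiable at \<open>0\<close>.\<close>

definition times_differentiable_at_0 :: "nat \<Rightarrow> (real \<Rightarrow> real) \<Rightarrow> bool" where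
  "times_differentiable_at_0 n f \<longleftrightarrow>
     (\<exists>\<epsilon>>0. \<forall>k. Suc k < n \<longrightarrow>
        (\<forall>x\<in>{0..<\<epsilon>}. nth_deriv_halfline k f differentiable (at x within {0..}))) \<and>
     (\<forall>k<n. nth_deriv_halfline k f differentiable (at 0 within {0..}))"

text \<open>The second disjunct is the degenerate law \<open>N(0, 0)\<close>, which has no density.\<close>

definition centered_gaussian :: "'w measure \<Rightarrow> ('w \<Rightarrow> real) \<Rightarrow> bool" where
  "centered_gaussian M X \<longleftrightarrow>
     (\<exists>\<sigma>>0. distributed M lborel X (normal_density 0 \<sigma>)) \<or>
     (X \<in> borel_measurable M \<and> (AE \<omega> in M. X \<omega> = 0))"

definition centered_gaussian_process :: "'w measure \<Rightarrow> ('i \<Rightarrow> 'w \<Rightarrow> real) \<Rightarrow> bool" where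
  "centered_gaussian_process M H \<longleftrightarrow>
     (\<forall>S c. finite S \<longrightarrow> centered_gaussian M (\<lambda>\<omega>. \<Sum>x\<in>S. c x * H x \<omega>))"

definition has_structure_function ::
    "'w measure \<Rightarrow> (real ^ 'n \<Rightarrow> 'w \<Rightarrow> real) \<Rightarrow> (real \<Rightarrow> real) \<Rightarrow> bool" where
  "has_structure_function M H D \<longleftrightarrow>
     (\<forall>x y. (\<integral>\<omega>. (H x \<omega> - H y \<omega>)\<^sup>2 \<partial>M) = D ((norm (x - y))\<^sup>2))"

definition structure_denom :: "(real \<Rightarrow> real) \<Rightarrow> real \<Rightarrow> real" where
  "structure_denom D r =
     sqrt (D r - (nth_deriv_halfline 1 D r)\<^sup>2 * r / nth_deriv_halfline 1 D 0)"

definition structure_alpha :: "(real \<Rightarrow> real) \<Rightarrow> real \<Rightarrow> real" where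
  "structure_alpha D r = 2 * nth_deriv_halfline 2 D r / structure_denom D r"

definition structure_beta :: "(real \<Rightarrow> real) \<Rightarrow> real \<Rightarrow> real" where
  "structure_beta D r =
     (nth_deriv_halfline 1 D r - nth_deriv_halfline 1 D 0) / structure_denom D r"

end

theory Submission
  imports Defs
begin

text \<open>Differentiability of \<open>D\<close> at \<open>0\<close> forces \<open>\<nu>\<close> to have finite first and second moments, by monotone
  convergence of difference quotients; then \<open>D'\<close> and \<open>D''\<close> are obtained under the integral sign.
  By the Cauchy-Schwarz inequality \<open>D(r) - r D'(r)\<^sup>2 / D'(0) \<ge> G := \<integral> (1 - e\<^sup>-\<^sup>r\<^sup>t - r t e\<^sup>-\<^sup>2\<^sup>r\<^sup>t) \<nu>(dt)\<close>,
  so with \<open>m = \<integral> t\<^sup>2 \<nu>(dt)\<close>, \<open>P = D'(0) - D'(r)\<close> and \<open>Q = - D''(r)\<close> it suffices that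
  \<open>2 m G > P\<^sup>2 + 2 r Q P\<close>. The difference of the two sides is a double integral against
  \<open>\<nu> \<times> \<nu>\<close>, and its symmetrised integrand is pointwise positive: on the diagonal this amounts to
  \<open>sinh t > t\<close>, and the off-diagonal defect is nonnegative because \<open>(1 - e\<^sup>-\<^sup>t) / t\<close> and \<open>e\<^sup>-\<^sup>t\<close> are both
  decreasing.\<close>

section \<open>Exponential inequalities and positivity of the kernel\<close>

text \<open>The numerator of the derivative is \<open>exp (- x) * (1 + x) - 1\<close>, nonpositive
  because \<open>1 + x \<le> exp x\<close>.\<close>

lemma one_minus_exp_quotient_antimono:
  fixes s t :: real
  assumes "0 < s" "s \<le> t"
  shows "(1 - exp (- t)) / t \<le> (1 - exp (- s)) / s"
proof (rule DERIV_nonpos_imp_nonincreasing [OF assms(2)])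
  fix x :: real assume "s \<le> x" "x \<le> t"
  then have x: "x > 0" using assms by simp
  have "exp (- x) * (1 + x) \<le> exp (- x) * exp x"
    by (intro mult_left_mono exp_ge_add_one_self) auto
  then have "exp (- x) * (1 + x) \<le> 1" by (simp add: exp_minus)
  then have "(exp (- x) * x - (1 - exp (- x))) / (x * x) \<le> 0"
    using x by (intro divide_nonpos_pos) (auto simp: algebra_simps)
  moreover have "((\<lambda>x. (1 - exp (- x)) / x) has_real_derivative
      (exp (- x) * x - (1 - exp (- x))) / (x * x)) (at x)"
    using x by (auto intro!: derivative_eq_intros)
  ultimately show "\<exists>y. ((\<lambda>x. (1 - exp (- x)) / x) has_real_derivative y) (at x) \<and> y \<le> 0"
    by blast
qed

text \<open>Division by \<open>2 * exp (- t)\<close> turns this into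
  \<open>t < sinh t\<close>.\<close>

lemma two_mult_exp_neg_less:
  fixes t :: real
  assumes "0 < t"
  shows "2 * t * exp (- t) < 1 - exp (- t) ^ 2"
proof -
  let ?f = "\<lambda>t::real. 1 - exp (- t) ^ 2 - 2 * t * exp (- t)"
  have "?f 0 < ?f t"
  proof (rule DERIV_pos_imp_increasing_open [OF assms])
    fix x :: real assume x: "0 < x" "x < t"
    have "1 + (- x) < exp (- x)" using exp_minus_greater[of x] x by simp
    then have "0 < 2 * exp (- x) * (exp (- x) - 1 + x)" by simp
    moreover have "(?f has_real_derivative 2 * exp (- x) * (exp (- x) - 1 + x)) (at x)"
      by (auto intro!: derivative_eq_intros simp: algebra_simps power2_eq_square)
    ultimately show "\<exists>y. (?f has_real_derivative y) (at x) \<and> 0 < y" by blast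
  qed (auto intro!: continuous_intros)
  then show ?thesis by simp
qed

text \<open>The symmetrised coefficient of \<open>\<nu>(ds) \<nu>(dt)\<close> in \<open>2 m G - P\<^sup>2 - 2 r Q P\<close> for \<open>r = 1\<close>, with the
  integrals of \<open>integrated_kernel_pos\<close>; general \<open>r\<close> follows by scaling.\<close>

definition moment_kernel :: "real \<Rightarrow> real \<Rightarrow> real" where
  "moment_kernel s t = s\<^sup>2 * (1 - exp (- t) - t * exp (- t) ^ 2) + t\<^sup>2 * (1 - exp (- s) - s * exp (- s) ^ 2)
     - s * (1 - exp (- s)) * (t * (1 - exp (- t)))
     - s\<^sup>2 * exp (- s) * (t * (1 - exp (- t))) - s * (1 - exp (- s)) * (t\<^sup>2 * exp (- t))"

text \<open>Divided by \<open>s\<^sup>2 * t\<^sup>2\<close>, the kernel is the sum of two diagonal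
  terms and half of \<open>(u s - u t) * (u s - u t + 2 * (v s - v t))\<close>, whose factors never
  have opposite signs.\<close>

lemma moment_kernel_pos:
  assumes "0 < s" "0 < t"
  shows "0 < moment_kernel s t"
proof -
  define u v where "u = (\<lambda>x::real. (1 - exp (- x)) / x)" and "v = (\<lambda>x::real. exp (- x))"
  \<comment> \<open>Equals \<open>moment_kernel x x / (2 * x ^ 4)\<close>, the normalised diagonal
    value.\<close>
  define d where "d = (\<lambda>x::real. (1 - v x ^ 2 - 2 * x * v x) / (2 * x\<^sup>2))"
  have d: "0 < d x" if "0 < x" for x
    using two_mult_exp_neg_less[OF that] that by (auto simp: d_def v_def)
  have uv: "0 \<le> (u s - u t) * (u s - u t + 2 * (v s - v t))"
  proof (cases "s \<le> t")
    case True
    then have "0 \<le> u s - u t" "0 \<le> v s - v t"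
      using one_minus_exp_quotient_antimono[of s t] assms by (auto simp: u_def v_def)
    then show ?thesis by simp
  next
    case False
    then have "u s - u t \<le> 0" "v s - v t \<le> 0"
      using one_minus_exp_quotient_antimono[of t s] assms by (auto simp: u_def v_def)
    then show ?thesis by (intro mult_nonpos_nonpos) auto
  qed
  \<comment> \<open>Rewriting everything through \<open>u\<close> leaves a polynomial identity in
    \<open>s\<close>, \<open>t\<close>, \<open>u s\<close> and \<open>u t\<close>.\<close>
  have e: "exp (- x) = 1 - x * u x" "v x = 1 - x * u x"
    "2 * x\<^sup>2 * d x = 1 - v x ^ 2 - 2 * x * v x" if "0 < x" for x
    using that by (auto simp: u_def v_def d_def)
  \<comment> \<open>the square completed on the diagonal values \<open>(u\<^sup>2 + 2 u v) / 2\<close> of the mixed terms\<close>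
  have "2 * moment_kernel s t = t\<^sup>2 * (2 * s\<^sup>2 * d s) + s\<^sup>2 * (2 * t\<^sup>2 * d t)
      + s\<^sup>2 * t\<^sup>2 * ((u s - u t) * (u s - u t + 2 * (v s - v t)))"
    unfolding moment_kernel_def e[OF assms(1)] e[OF assms(2)] by algebra
  then have "moment_kernel s t = s\<^sup>2 * t\<^sup>2 * (d s + d t + (u s - u t) * (u s - u t + 2 * (v s - v t)) / 2)"
    by (simp add: distrib_left mult.assoc mult.left_commute add_divide_distrib)
  moreover have "0 < d s + d t + (u s - u t) * (u s - u t + 2 * (v s - v t)) / 2"
    using d[OF assms(1)] d[OF assms(2)] uv by simp
  ultimately show ?thesis using assms by simp
qed

section \<open>Moments of \<open>\<nu>\<close> and differentiation under the integral sign\<close>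

text \<open>Supplies the integrable majorant of the difference quotients in
  \<open>has_derivative_integral_one_minus_exp\<close>.\<close>

lemma abs_exp_neg_diff_le:
  fixes x y t :: real
  assumes "0 \<le> x" "0 \<le> y" "0 \<le> t"
  shows "\<bar>exp (- (x * t)) - exp (- (y * t))\<bar> \<le> \<bar>x - y\<bar> * t"
proof -
  have *: "exp (- (a * t)) - exp (- (b * t)) \<le> (b - a) * t" if "0 \<le> a" "a \<le> b" for a b
  proof -
    have "exp (- (a * t)) - exp (- (b * t)) = exp (- (a * t)) * (1 - exp (- ((b - a) * t)))"
      by (simp add: algebra_simps flip: exp_add)
    also have "\<dots> \<le> 1 * ((b - a) * t)"
      using that assms exp_ge_add_one_self[of "- ((b - a) * t)"] by (intro mult_mono) auto
    finally show ?thesis by simp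
  qed
  have mono: "exp (- (b * t)) \<le> exp (- (a * t))" if "a \<le> b" for a b
    using that assms by (simp add: mult_right_mono)
  show ?thesis using *[of x y] *[of y x] mono[of x y] mono[of y x] assms by (cases "x \<le> y") auto
qed

lemma tendsto_quotient_at_0_sequentially:
  fixes F :: "real \<Rightarrow> real"
  assumes "F differentiable (at 0 within {0..})" "F 0 = 0"
  shows "\<exists>d. (\<lambda>n. F (1 / real (Suc n)) * real (Suc n)) \<longlonglongrightarrow> d"
proof -
  obtain d where "(F has_real_derivative d) (at 0 within {0..})"
    using assms(1) real_differentiable_def by blast
  then have "((\<lambda>y. F y / y) \<longlongrightarrow> d) (at 0 within {0..})"
    by (simp add: has_field_derivative_iff assms(2))
  then have "((\<lambda>y. F y / y) \<circ> (\<lambda>n. 1 / real (Suc n))) \<longlonglongrightarrow> d"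
    unfolding tendsto_at_iff_sequentially
    using LIMSEQ_inverse_real_of_nat by (auto simp: inverse_eq_divide)
  then show ?thesis by (auto simp: o_def)
qed

locale halfline_measure =
  fixes \<nu> :: "real measure"
  assumes measurable_ident_real [measurable]: "(\<lambda>t. t) \<in> borel_measurable \<nu>"
    and space_pos: "\<And>t. t \<in> space \<nu> \<Longrightarrow> 0 < t"
begin

text \<open>Gains one moment from one derivative at \<open>0\<close>. With \<open>f t = 1\<close> it
  yields the first moment from \<open>D s - A * s\<close>, with \<open>f t = t\<close> the second
  from \<open>D'\<close>.\<close>

lemma integrable_mult_ident_of_differentiable:
  fixes f :: "real \<Rightarrow> real"
  assumes [measurable]: "f \<in> borel_measurable \<nu>"
    and nonneg: "\<And>t. 0 < t \<Longrightarrow> 0 \<le> f t"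
    and int: "\<And>r. 0 \<le> r \<Longrightarrow> integrable \<nu> (\<lambda>t. f t * (1 - exp (- (r * t))))"
    and F: "\<And>r. 0 \<le> r \<Longrightarrow> F r = (\<integral>t. f t * (1 - exp (- (r * t))) \<partial>\<nu>)"
    and diff: "F differentiable (at 0 within {0..})"
  shows "integrable \<nu> (\<lambda>t. f t * t)"
proof -
  \<comment> \<open>The difference quotient at \<open>0\<close> with step
    \<open>1 / (n + 1)\<close>, whose integral is that of \<open>F\<close>.\<close>
  define q where "q = (\<lambda>n t. f t * (1 - exp (- (1 / real (Suc n) * t))) * real (Suc n))"
  obtain d where d: "(\<lambda>n. F (1 / real (Suc n)) * real (Suc n)) \<longlonglongrightarrow> d"
    using tendsto_quotient_at_0_sequentially[OF diff] F[of 0] by auto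
  show ?thesis
  proof (rule integrable_monotone_convergence[where f = q])
    show "integrable \<nu> (q i)" for i
      unfolding q_def using int[of "1 / real (Suc i)"] by (intro integrable_mult_left) auto
    show "AE t in \<nu>. mono (\<lambda>n. q n t)"
    proof (rule AE_I2, rule monoI)
      fix t m n assume t: "t \<in> space \<nu>" and mn: "(m::nat) \<le> n"
      \<comment> \<open>The argument \<open>t / (k + 1)\<close> of the decreasing quotient shrinks
        as \<open>k\<close> grows, so \<open>q k t\<close> increases in \<open>k\<close>.\<close>
      have q: "q k t = f t * t * ((1 - exp (- (t / real (Suc k)))) / (t / real (Suc k)))" for k
        using space_pos[OF t] by (simp add: q_def)
      show "q m t \<le> q n t"
        unfolding q using space_pos[OF t] mn nonneg
        by (intro mult_left_mono one_minus_exp_quotient_antimono divide_left_mono) auto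
    qed
    show "AE t in \<nu>. (\<lambda>n. q n t) \<longlonglongrightarrow> f t * t"
    proof (rule AE_I2)
      fix t assume "t \<in> space \<nu>"
      have "((\<lambda>r. f t * (1 - exp (- (r * t)))) has_real_derivative f t * t) (at 0 within {0..})"
        by (auto intro!: derivative_eq_intros)
      then have "((\<lambda>y. f t * (1 - exp (- (y * t))) / y) \<longlongrightarrow> f t * t) (at 0 within {0..})"
        by (simp add: has_field_derivative_iff)
      then have "((\<lambda>y. f t * (1 - exp (- (y * t))) / y) \<circ> (\<lambda>n. 1 / real (Suc n))) \<longlonglongrightarrow> f t * t"
        unfolding tendsto_at_iff_sequentially
        using LIMSEQ_inverse_real_of_nat by (auto simp: inverse_eq_divide)
      then show "(\<lambda>n. q n t) \<longlonglongrightarrow> f t * t" by (simp add: q_def o_def)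
    qed
    have "integral\<^sup>L \<nu> (q n) = F (1 / real (Suc n)) * real (Suc n)" for n
      unfolding q_def by (simp add: F)
    with d show "(\<lambda>n. integral\<^sup>L \<nu> (q n)) \<longlonglongrightarrow> d" by simp
    show "(\<lambda>t. f t * t) \<in> borel_measurable \<nu>" by measurable
  qed
qed

text \<open>Dominated convergence along an arbitrary sequence in the half-line, with majorant
  \<open>\<bar>f t * t\<bar>\<close>; the case \<open>x = 0\<close> gives the one-sided
  derivative.\<close>

lemma has_derivative_integral_one_minus_exp:
  fixes f :: "real \<Rightarrow> real"
  assumes [measurable]: "f \<in> borel_measurable \<nu>"
    and int: "\<And>r. 0 \<le> r \<Longrightarrow> integrable \<nu> (\<lambda>t. f t * (1 - exp (- (r * t))))"
    and int': "integrable \<nu> (\<lambda>t. f t * t)"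
    and x: "0 \<le> x"
  shows "((\<lambda>r. \<integral>t. f t * (1 - exp (- (r * t))) \<partial>\<nu>) has_real_derivative
          (\<integral>t. f t * t * exp (- (x * t)) \<partial>\<nu>)) (at x within {0..})"
  unfolding has_field_derivative_iff tendsto_at_iff_sequentially o_def
proof (intro allI impI)
  fix X :: "nat \<Rightarrow> real"
  assume "\<forall>i. X i \<in> {0..} - {x}" and lim: "X \<longlonglongrightarrow> x"
  then have X: "0 \<le> X i" "X i \<noteq> x" for i by auto
  let ?q = "\<lambda>i t. (f t * (1 - exp (- (X i * t))) - f t * (1 - exp (- (x * t)))) / (X i - x)"
  have "(\<lambda>i. \<integral>t. ?q i t \<partial>\<nu>) \<longlonglongrightarrow> (\<integral>t. f t * t * exp (- (x * t)) \<partial>\<nu>)"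
  proof (rule integral_dominated_convergence[where w = "\<lambda>t. \<bar>f t * t\<bar>"])
    show "integrable \<nu> (\<lambda>t. \<bar>f t * t\<bar>)" using int' by (rule integrable_abs)
    show "AE t in \<nu>. (\<lambda>i. ?q i t) \<longlonglongrightarrow> f t * t * exp (- (x * t))"
    proof (rule AE_I2)
      fix t
      have "((\<lambda>r. f t * (1 - exp (- (r * t)))) has_real_derivative f t * t * exp (- (x * t)))
          (at x within {0..})"
        by (auto intro!: derivative_eq_intros)
      then show "(\<lambda>i. ?q i t) \<longlonglongrightarrow> f t * t * exp (- (x * t))"
        unfolding has_field_derivative_iff tendsto_at_iff_sequentially o_def
        using X lim by auto
    qed
    show "AE t in \<nu>. norm (?q i t) \<le> \<bar>f t * t\<bar>" for i
    proof (rule AE_I2)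
      fix t assume "t \<in> space \<nu>"
      then have t: "0 < t" by (rule space_pos)
      have eq: "?q i t = f t * ((exp (- (x * t)) - exp (- (X i * t))) / (X i - x))"
        by (simp add: algebra_simps)
      have "\<bar>exp (- (x * t)) - exp (- (X i * t))\<bar> \<le> t * \<bar>X i - x\<bar>"
        using abs_exp_neg_diff_le[of x "X i" t] X[of i] t x by (simp add: abs_minus_commute mult.commute)
      then have "\<bar>exp (- (x * t)) - exp (- (X i * t))\<bar> / \<bar>X i - x\<bar> \<le> t"
        using X[of i] by (simp add: pos_divide_le_eq)
      then have "\<bar>f t\<bar> * (\<bar>exp (- (x * t)) - exp (- (X i * t))\<bar> / \<bar>X i - x\<bar>) \<le> \<bar>f t\<bar> * t"
        by (intro mult_left_mono) auto
      then show "norm (?q i t) \<le> \<bar>f t * t\<bar>"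
        unfolding eq using t by (simp add: abs_mult)
    qed
  qed measurable
  moreover have "(\<integral>t. ?q i t \<partial>\<nu>) = ((\<integral>t. f t * (1 - exp (- (X i * t))) \<partial>\<nu>)
      - (\<integral>t. f t * (1 - exp (- (x * t))) \<partial>\<nu>)) / (X i - x)" for i
    by (simp only: integral_divide_zero Bochner_Integration.integral_diff[OF int[OF X(1)] int[OF x]])
  ultimately show "(\<lambda>i. ((\<integral>t. f t * (1 - exp (- (X i * t))) \<partial>\<nu>)
      - (\<integral>t. f t * (1 - exp (- (x * t))) \<partial>\<nu>)) / (X i - x))
      \<longlonglongrightarrow> (\<integral>t. f t * t * exp (- (x * t)) \<partial>\<nu>)" by (simp only:)
qed

lemma integral_strict_pos:
  fixes f :: "real \<Rightarrow> real"
  assumes "integrable \<nu> f" "\<And>t. 0 < t \<Longrightarrow> 0 < f t" "emeasure \<nu> (space \<nu>) \<noteq> 0"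
  shows "0 < integral\<^sup>L \<nu> f"
proof -
  have "0 \<le> integral\<^sup>L \<nu> f"
    using assms(2) space_pos by (intro integral_nonneg_AE AE_I2) (auto intro: less_imp_le)
  moreover have "integral\<^sup>L \<nu> f \<noteq> 0"
  proof
    assume "integral\<^sup>L \<nu> f = 0"
    moreover have "AE t in \<nu>. 0 \<le> f t"
      using assms(2) space_pos by (auto intro!: AE_I2 less_imp_le)
    ultimately have "AE t in \<nu>. f t = 0"
      using integral_nonneg_eq_0_iff_AE assms(1) by blast
    then have "AE t in \<nu>. False"
      by (rule AE_mp) (use assms(2) space_pos in \<open>force intro!: AE_I2\<close>)
    then show False using assms(3) by (simp add: AE_iff_null null_setsD1)
  qed
  ultimately show ?thesis by simp
qed

lemma integrable_dominated:
  fixes f g :: "real \<Rightarrow> real"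
  assumes "integrable \<nu> g" "f \<in> borel_measurable \<nu>" "\<And>t. 0 < t \<Longrightarrow> \<bar>f t\<bar> \<le> g t"
  shows "integrable \<nu> f"
  by (rule Bochner_Integration.integrable_bound[OF assms(1,2)])
    (use assms(3) space_pos in \<open>auto intro!: AE_I2 intro: order_trans[OF _ abs_ge_self]\<close>)

end

section \<open>Integral inequalities under finite first and second moments\<close>

lemma one_minus_exp_bounds:
  fixes r t :: real
  assumes "0 \<le> r" "0 < t"
  shows "0 \<le> 1 - exp (- (r * t))" "1 - exp (- (r * t)) \<le> 1" "1 - exp (- (r * t)) \<le> r * t"
    "\<bar>1 - exp (- (r * t))\<bar> \<le> 1"
  using assms exp_ge_add_one_self[of "- (r * t)"] by auto

locale second_moment_measure = halfline_measure +
  assumes integrable_ident: "integrable \<nu> (\<lambda>t. t)"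
    and integrable_square: "integrable \<nu> (\<lambda>t. t\<^sup>2)"
begin

lemma integrable_intros [simp]:
  assumes "0 \<le> r"
  shows "integrable \<nu> (\<lambda>t. 1 - exp (- (r * t)))" (is ?A)
    and "integrable \<nu> (\<lambda>t. t * (1 - exp (- (r * t))))" (is ?B)
    and "integrable \<nu> (\<lambda>t. t * exp (- (r * t)))" (is ?C)
    and "integrable \<nu> (\<lambda>t. t * exp (- (r * t)) ^ 2)" (is ?E)
    and "integrable \<nu> (\<lambda>t. t\<^sup>2 * exp (- (r * t)))" (is ?F)
proof -
  note b = one_minus_exp_bounds[OF assms]
  show ?A
  proof (rule integrable_dominated)
    show "integrable \<nu> (\<lambda>t. r * t)" using integrable_ident by simp
  qed (use b in auto)
  show ?B
    by (rule integrable_dominated[OF integrable_ident]; (measurable)?)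
      (simp add: b abs_mult mult_left_le)
  show ?C
    by (rule integrable_dominated[OF integrable_ident]; (measurable)?)
      (simp add: assms abs_mult mult_left_le)
  show ?E
    by (rule integrable_dominated[OF integrable_ident]; (measurable)?)
      (simp add: assms abs_mult mult_left_le power_le_one)
  show ?F
    by (rule integrable_dominated[OF integrable_square]; (measurable)?)
      (simp add: assms abs_mult mult_left_le)
qed

text \<open>For a fixed first argument the kernel integrates to an affine combination of the integrals
  below, so integrating twice needs no product measure.\<close>

lemma integrated_kernel_pos:
  assumes r: "0 < r" and nontrivial: "emeasure \<nu> (space \<nu>) \<noteq> 0"
  defines "G \<equiv> \<integral>t. (1 - exp (- (r * t)) - r * (t * exp (- (r * t)) ^ 2)) \<partial>\<nu>"
    and "P \<equiv> \<integral>t. t * (1 - exp (- (r * t))) \<partial>\<nu>"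
    and "Q \<equiv> \<integral>t. t\<^sup>2 * exp (- (r * t)) \<partial>\<nu>"
    and "m \<equiv> \<integral>t. t\<^sup>2 \<partial>\<nu>"
  shows "P\<^sup>2 + 2 * r * Q * P < 2 * m * G"
proof -
  define g p q where "g = (\<lambda>t. 1 - exp (- (r * t)) - r * (t * exp (- (r * t)) ^ 2))"
    and "p = (\<lambda>t. t * (1 - exp (- (r * t))))" and "q = (\<lambda>t. t\<^sup>2 * exp (- (r * t)))"
  have int: "integrable \<nu> g" "integrable \<nu> p" "integrable \<nu> q" "integrable \<nu> (\<lambda>t. t\<^sup>2)"
    unfolding g_def p_def q_def using r integrable_square
    by (auto intro!: integrable_intros Bochner_Integration.integrable_diff integrable_mult_right)
  have I: "integral\<^sup>L \<nu> g = G" "integral\<^sup>L \<nu> p = P" "integral\<^sup>L \<nu> q = Q" "(\<integral>t. t\<^sup>2 \<partial>\<nu>) = m"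
    by (simp_all add: g_def p_def q_def G_def P_def Q_def m_def)
  define k where "k = (\<lambda>s t. s\<^sup>2 * g t + g s * t\<^sup>2 - p s * p t - r * q s * p t - r * p s * q t)"
  have k: "0 < k s t" if "0 < s" "0 < t" for s t
  proof -
    have "moment_kernel (r * s) (r * t) = r\<^sup>2 * k s t"
      unfolding moment_kernel_def k_def g_def p_def q_def by (simp add: algebra_simps power2_eq_square)
    then show ?thesis using moment_kernel_pos[of "r * s" "r * t"] that r by (simp add: zero_less_mult_iff)
  qed
  have "0 < s\<^sup>2 * G + g s * m - p s * P - r * q s * P - r * p s * Q" if "0 < s" for s
  proof -
    have "(\<integral>t. k s t \<partial>\<nu>) = s\<^sup>2 * G + g s * m - p s * P - r * q s * P - r * p s * Q"
      unfolding k_def using int by (simp add: I)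
    moreover have "0 < (\<integral>t. k s t \<partial>\<nu>)"
      by (rule integral_strict_pos) (use k that nontrivial int in \<open>auto simp: k_def\<close>)
    ultimately show ?thesis by simp
  qed
  then have "0 < (\<integral>s. (s\<^sup>2 * G + g s * m - p s * P - r * q s * P - r * p s * Q) \<partial>\<nu>)"
    using int nontrivial by (intro integral_strict_pos) auto
  also have "\<dots> = m * G + G * m - P * P - r * Q * P - r * P * Q"
    using int by (simp add: I)
  finally show ?thesis by (simp add: algebra_simps power2_eq_square)
qed

text \<open>The Cauchy-Schwarz inequality for the measure \<open>t \<nu>(dt) + A \<delta>\<^sub>0\<close>.\<close>

lemma cauchy_schwarz_exp:
  assumes r: "0 < r" and A: "0 \<le> A" and a: "a = (\<integral>t. t \<partial>\<nu>) + A" "0 < a"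
    and b: "b = (\<integral>t. t * exp (- (r * t)) \<partial>\<nu>) + A"
  shows "b\<^sup>2 / a \<le> (\<integral>t. t * exp (- (r * t)) ^ 2 \<partial>\<nu>) + A"
proof -
  \<comment> \<open>The mean of \<open>exp (- (r * t))\<close> under the normalised measure, which
    minimises the quadratic in \<open>c\<close> below.\<close>
  define c where "c = b / a"
  let ?J = "\<integral>t. t * exp (- (r * t)) ^ 2 \<partial>\<nu>"
  have "0 \<le> (\<integral>t. t * (exp (- (r * t)) - c)\<^sup>2 \<partial>\<nu>)"
    by (intro integral_nonneg_AE AE_I2 mult_nonneg_nonneg) (simp_all add: space_pos less_imp_le)
  also have "\<dots> = (\<integral>t. t * exp (- (r * t)) ^ 2 - 2 * c * (t * exp (- (r * t))) + c\<^sup>2 * t \<partial>\<nu>)"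
    by (rule Bochner_Integration.integral_cong) (auto simp: algebra_simps power2_eq_square)
  also have "\<dots> = ?J - 2 * c * (b - A) + c\<^sup>2 * (a - A)"
    using r integrable_ident by (simp add: a b)
  \<comment> \<open>The subtracted term is the contribution of the atom at \<open>0\<close>, where
    \<open>exp (- (r * t)) = 1\<close>.\<close>
  finally have "0 \<le> ?J + A - 2 * c * b + c\<^sup>2 * a - A * (1 - c)\<^sup>2"
    by (simp add: algebra_simps power2_eq_square)
  moreover have "0 \<le> A * (1 - c)\<^sup>2" using A by simp
  moreover have "2 * c * b - c\<^sup>2 * a = b\<^sup>2 / a"
    using a(2) by (simp add: c_def field_simps power2_eq_square)
  ultimately show ?thesis by linarith
qed

end

section \<open>Derivatives of \<open>D\<close> and the final estimate\<close>

text \<open>Formulas for \<open>D\<close> and its derivatives hold only on the half-line; agreement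
  there suffices, since the derivative is taken within \<open>{0..}\<close>.\<close>

lemma deriv_halfline_cong_eqI:
  assumes "\<And>y. 0 \<le> y \<Longrightarrow> f y = g y" "(g has_real_derivative d) (at x within {0..})" "0 \<le> x"
  shows "deriv_halfline f x = d"
  proof (rule deriv_halfline_eqI[OF _ assms(3)])
  show "(f has_real_derivative d) (at x within {0..})"
    using assms(2) unfolding has_field_derivative_def
    by (rule has_derivative_transform[rotated 2]) (use assms(1,3) in auto)
qed

theorem theorem3p3:
  fixes D :: "real \<Rightarrow> real" and A :: real and \<nu> :: "real measure"
    and M :: "'w measure" and H :: "real ^ 'n \<Rightarrow> 'w \<Rightarrow> real"
  assumes A_nonneg: "A \<ge> 0"
    and nu_on: "sets \<nu> = sets (restrict_space borel {0<..})"
    and nu_sigma_finite: "sigma_finite_measure \<nu>"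
    and nu_integral: "(\<integral>\<^sup>+ t. ennreal (t / (1 + t)) \<partial>\<nu>) < \<infinity>"
    and D_form: "\<And>r. r \<ge> 0 \<Longrightarrow> D r = (\<integral>t. (1 - exp (- (r * t))) \<partial>\<nu>) + A * r"
    and smooth: "times_differentiable_at_0 4 D"
    and D4: "0 < \<bar>nth_deriv_halfline 4 D 0\<bar>"
    and prob: "prob_space M"
    and gaussian: "centered_gaussian_process M H"
    and increments: "has_structure_function M H D"
    and pinned: "AE \<omega> in M. H 0 \<omega> = 0"
  shows "\<forall>r>0. - 2 * nth_deriv_halfline 2 D 0 >
           (structure_alpha D r * r + structure_beta D r) * structure_beta D r"
proof (intro allI impI)
  fix r :: real assume r: "0 < r"
  have space: "space \<nu> = {0<..}"
    using sets_eq_imp_space_eq[OF nu_on] by (simp add: space_restrict_space)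
  interpret halfline_measure \<nu>
  proof
    show "(\<lambda>t. t) \<in> borel_measurable \<nu>"
      by (subst measurable_cong_sets[OF nu_on refl]) (intro measurable_restrict_space1, simp)
  qed (use space in auto)
  have diff: "nth_deriv_halfline k D differentiable (at 0 within {0..})" if "k < 4" for k
    using smooth that by (auto simp: times_differentiable_at_0_def)
  have int0: "integrable \<nu> (\<lambda>t. t / (1 + t))"
  proof (rule integrableI_nonneg)
    show "(\<lambda>t. t / (1 + t)) \<in> borel_measurable \<nu>" by measurable
    show "AE t in \<nu>. 0 \<le> t / (1 + t)" by (rule AE_I2) (simp add: space)
  qed (rule nu_integral)
  \<comment> \<open>The factor \<open>1\<close> matches the lemmas above with
    \<open>f t = 1\<close>. The majorant comes from multiplying by \<open>1 + t\<close> and bounding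
    \<open>1 - exp (- (s * t))\<close> by \<open>s * t\<close> in one summand and by
    \<open>1\<close> in the other.\<close>
  have int1: "integrable \<nu> (\<lambda>t. 1 * (1 - exp (- (s * t))))" if s: "0 \<le> s" for s
  proof (rule integrable_dominated[of "\<lambda>t. (1 + s) * (t / (1 + t))"])
    fix t :: real assume t: "0 < t"
    note b = one_minus_exp_bounds[OF s t]
    have "(1 - exp (- (s * t))) * (1 + t) = (1 - exp (- (s * t))) + (1 - exp (- (s * t))) * t"
      by (simp add: algebra_simps)
    also have "\<dots> \<le> s * t + 1 * t" using b t by (intro add_mono mult_right_mono) auto
    finally have "1 - exp (- (s * t)) \<le> (s * t + 1 * t) / (1 + t)"
      using t by (simp only: pos_le_divide_eq add_pos_pos zero_less_one)
    also have "\<dots> = (1 + s) * (t / (1 + t))" by (simp add: algebra_simps)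
    finally show "\<bar>1 * (1 - exp (- (s * t)))\<bar> \<le> (1 + s) * (t / (1 + t))"
      using b(1) by simp
  next
    show "integrable \<nu> (\<lambda>t. (1 + s) * (t / (1 + t)))" using int0 by (rule integrable_mult_right)
  qed measurable
  have F0: "D s - A * s = (\<integral>t. 1 * (1 - exp (- (s * t))) \<partial>\<nu>)" if "0 \<le> s" for s
    using D_form[OF that] by simp
  have diff0: "(\<lambda>s. D s - A * s) differentiable (at 0 within {0..})"
    using diff[of 0] by (intro derivative_intros) auto
  have m1: "integrable \<nu> (\<lambda>t. t)"
    using integrable_mult_ident_of_differentiable[of "\<lambda>_. 1" "\<lambda>s. D s - A * s", OF _ _ int1 F0 diff0]
    by simp
  have D1: "nth_deriv_halfline 1 D s = (\<integral>t. t * exp (- (s * t)) \<partial>\<nu>) + A" if s: "0 \<le> s" for s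
  proof -
    have "((\<lambda>r. \<integral>t. 1 * (1 - exp (- (r * t))) \<partial>\<nu>) has_real_derivative
        (\<integral>t. 1 * t * exp (- (s * t)) \<partial>\<nu>)) (at s within {0..})"
      by (rule has_derivative_integral_one_minus_exp[OF _ int1 _ s]) (simp_all add: m1)
    from DERIV_add[OF this DERIV_cmult_Id[of A]]
    have "deriv_halfline D s = (\<integral>t. 1 * t * exp (- (s * t)) \<partial>\<nu>) + A"
      by (rule deriv_halfline_cong_eqI[OF _ _ s, rotated]) (simp add: D_form)
    then show ?thesis by simp
  qed
  have int2: "integrable \<nu> (\<lambda>t. t * (1 - exp (- (s * t))))" if "0 \<le> s" for s
    by (rule integrable_dominated[OF m1]; (measurable)?)
      (simp add: one_minus_exp_bounds[OF that] abs_mult mult_left_le)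
  define a where "a = (\<integral>t. t \<partial>\<nu>) + A"
  have D1': "nth_deriv_halfline 1 D s = a - (\<integral>t. t * (1 - exp (- (s * t))) \<partial>\<nu>)"
    if "0 \<le> s" for s
  proof -
    have "(\<integral>t. t * exp (- (s * t)) \<partial>\<nu>) = (\<integral>t. t - t * (1 - exp (- (s * t))) \<partial>\<nu>)"
      by (simp add: algebra_simps)
    also have "\<dots> = (\<integral>t. t \<partial>\<nu>) - (\<integral>t. t * (1 - exp (- (s * t))) \<partial>\<nu>)"
      using m1 int2[OF that] by (rule Bochner_Integration.integral_diff)
    finally show ?thesis unfolding D1[OF that] a_def by simp
  qed
  \<comment> \<open>This has the same shape as \<open>F0\<close> with \<open>f t = t\<close>, so the
    moment lemma applies once more.\<close>
  have F1: "a - nth_deriv_halfline 1 D s = (\<integral>t. t * (1 - exp (- (s * t))) \<partial>\<nu>)" if "0 \<le> s" for s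
    using D1'[OF that] by simp
  have diff1: "(\<lambda>s. a - nth_deriv_halfline 1 D s) differentiable (at 0 within {0..})"
    using diff[of 1] by (intro derivative_intros) auto
  have m2: "integrable \<nu> (\<lambda>t. t\<^sup>2)"
    using integrable_mult_ident_of_differentiable[OF _ _ int2 F1 diff1]
    by (simp add: power2_eq_square)
  interpret second_moment_measure \<nu> by unfold_locales (rule m1, rule m2)
  have D2: "nth_deriv_halfline 2 D s = - (\<integral>t. t\<^sup>2 * exp (- (s * t)) \<partial>\<nu>)" if s: "0 \<le> s" for s
  proof -
    have "((\<lambda>r. \<integral>t. t * (1 - exp (- (r * t))) \<partial>\<nu>) has_real_derivative
        (\<integral>t. t * t * exp (- (s * t)) \<partial>\<nu>)) (at s within {0..})"
      by (rule has_derivative_integral_one_minus_exp[OF _ int2 _ s])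
        (simp_all add: m2 flip: power2_eq_square)
    from DERIV_diff[OF DERIV_const[of a] this]
    have "deriv_halfline (nth_deriv_halfline 1 D) s = 0 - (\<integral>t. t * t * exp (- (s * t)) \<partial>\<nu>)"
      by (rule deriv_halfline_cong_eqI[OF _ _ s, rotated]) (rule D1')
    then show ?thesis by (simp add: numeral_2_eq_2 power2_eq_square)
  qed
  \<comment> \<open>For null \<open>\<nu>\<close> the function \<open>D\<close> is linear on the
    half-line, so its fourth derivative at \<open>0\<close> would vanish, against
    \<open>D4\<close>.\<close>
  have nontrivial: "emeasure \<nu> (space \<nu>) \<noteq> 0"
  proof
    assume "emeasure \<nu> (space \<nu>) = 0"
    then have "AE t in \<nu>. t\<^sup>2 * exp (- (s * t)) = 0" for s
      by (intro AE_I[where N = "space \<nu>"]) auto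
    then have z: "nth_deriv_halfline 2 D s = 0" if "0 \<le> s" for s
      unfolding D2[OF that] neg_equal_0_iff_equal by (intro integral_eq_zero_AE)
    have step: "nth_deriv_halfline (Suc k) D s = 0"
      if "\<And>s. 0 \<le> s \<Longrightarrow> nth_deriv_halfline k D s = 0" "0 \<le> s" for k s
      using that by (auto intro!: deriv_halfline_cong_eqI[where g = "\<lambda>_. 0"])
    have "nth_deriv_halfline (Suc (Suc 2)) D 0 = 0" by (intro step z order_refl)
    moreover have "4 = Suc (Suc 2)" by simp
    ultimately show False using D4 by (simp only: abs_zero less_irrefl)
  qed
  define G P Q m where "G = (\<integral>t. (1 - exp (- (r * t)) - r * (t * exp (- (r * t)) ^ 2)) \<partial>\<nu>)"
    and "P = (\<integral>t. t * (1 - exp (- (r * t))) \<partial>\<nu>)"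
    and "Q = (\<integral>t. t\<^sup>2 * exp (- (r * t)) \<partial>\<nu>)" and "m = (\<integral>t. t\<^sup>2 \<partial>\<nu>)"
  note defs = G_def P_def Q_def m_def
  have ineq: "P\<^sup>2 + 2 * r * Q * P < 2 * m * G"
    unfolding defs by (rule integrated_kernel_pos[OF r nontrivial])
  have m_pos: "0 < m"
    unfolding m_def by (rule integral_strict_pos[OF m2 _ nontrivial]) auto
  have "0 \<le> P"
    unfolding P_def using r by (intro integral_nonneg_AE AE_I2) (simp add: space)
  moreover have "0 \<le> Q" unfolding Q_def by simp
  ultimately have "0 \<le> P\<^sup>2 + 2 * r * Q * P" using r by simp
  \<comment> \<open>Positivity of \<open>G\<close> is read off from \<open>ineq\<close>; through
    \<open>G \<le> S\<close> it makes the denominator \<open>sqrt S\<close> positive.\<close>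
  with ineq m_pos have G_pos: "0 < G" by (smt (verit) mult_nonneg_nonpos)
  have a_pos: "0 < a"
    unfolding a_def using integral_strict_pos[OF m1 _ nontrivial] A_nonneg by simp
  define b where "b = (\<integral>t. t * exp (- (r * t)) \<partial>\<nu>) + A"
  define S where "S = D r - b\<^sup>2 * r / a"
  have "G = (\<integral>t. (1 - exp (- (r * t))) \<partial>\<nu>) - r * (\<integral>t. t * exp (- (r * t)) ^ 2 \<partial>\<nu>)"
    unfolding G_def using r by simp
  moreover have "b\<^sup>2 / a \<le> (\<integral>t. t * exp (- (r * t)) ^ 2 \<partial>\<nu>) + A"
    by (rule cauchy_schwarz_exp[OF r A_nonneg a_def a_pos b_def])
  then have "r * (b\<^sup>2 / a) \<le> r * ((\<integral>t. t * exp (- (r * t)) ^ 2 \<partial>\<nu>) + A)"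
    using r by (intro mult_left_mono) auto
  \<comment> \<open>The drift \<open>A * r\<close> in \<open>D r\<close> cancels against
    \<open>r * A\<close> from the Cauchy-Schwarz bound.\<close>
  ultimately have GS: "G \<le> S"
    using D_form[of r] r by (simp add: S_def algebra_simps)
  then have S_pos: "0 < S" using G_pos by simp
  have D10: "nth_deriv_halfline 1 D 0 = a" using D1[of 0] by (simp add: a_def)
  have D1r: "nth_deriv_halfline 1 D r = b" using D1[of r] r by (simp add: b_def)
  have bP: "b = a - P" using D1'[of r] D1r r by (simp add: P_def)
  have D20: "nth_deriv_halfline 2 D 0 = - m" using D2[of 0] by (simp add: m_def)
  have D2r: "nth_deriv_halfline 2 D r = - Q" using D2[of r] r by (simp add: Q_def)
  have denom: "structure_denom D r = sqrt S"
    unfolding structure_denom_def D10 D1r S_def ..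
  \<comment> \<open>The signs cancel in the product: \<open>D''(r) = - Q\<close> and
    \<open>D'(r) - D'(0) = - P\<close>.\<close>
  have "(structure_alpha D r * r + structure_beta D r) * structure_beta D r
      = (2 * r * Q + P) * P / (sqrt S * sqrt S)"
    unfolding structure_alpha_def structure_beta_def denom D10 D1r D2r bP
    using S_pos by (simp add: field_simps)
  also have "\<dots> = (P\<^sup>2 + 2 * r * Q * P) / S"
    using S_pos by (simp add: algebra_simps power2_eq_square)
  also have "\<dots> < 2 * m"
  proof -
    have "2 * m * G \<le> 2 * m * S" using GS m_pos by simp
    with ineq have "P\<^sup>2 + 2 * r * Q * P < 2 * m * S" by linarith
    then show ?thesis using S_pos by (simp add: pos_divide_less_eq)
  qed
  finally show "(structure_alpha D r * r + structure_beta D r) * structure_beta D r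
      < - 2 * nth_deriv_halfline 2 D 0"
    by (simp add: D20)
qed

end
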